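(* For every positive integer $d$ there exists a constant $c_d>0$, depending only on $d$, such that for every integer $n\ge 2$ there exists a set $X\subset\mathbb{R}^d$ with $|X|=n$ such that $$\operatorname{disc}(X,\mathcal{H}_d)\ \ge\ c_d\, n^{\frac12-\frac1{d+1}}\,(\log n)^{-1},$$ where $\mathcal{H}_d$ denotes the family of all (affine) hyperplanes in $\mathbb{R}^d$.
   Context: For a finite set $X\subset\mathbb{R}^d$ and a family $\mathcal{R}$ of subsets of $\mathbb{R}^d$, the (combinatorial, red-blue) discrepancy is $$\operatorname{disc}(X,\mathcal{R})=\min_{\chi:X\to\{-1,1\}}\ \max_{A\in\mathcal{R}}\ \Bigl|\sum_{x\in A\cap X}\chi(x)\Bigr|.$$ *)

theory Defs
  imports "HOL-Analysis.Analysis"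
begin

text \<open>The family \<open>R\<close> may be infinite. For finite \<open>X\<close> the inner \<open>Max\<close> still ranges over a finite
  set of values, since \<open>A \<inter> X\<close> takes only finitely many values; for infinite \<open>X\<close> or empty \<open>R\<close>
  the value of \<open>disc\<close> is irrelevant. The colourings are the extensional functions on \<open>X\<close>, so
  that there are finitely many of them.\<close>

definition disc :: "'a set \<Rightarrow> 'a set set \<Rightarrow> int" where
  "disc X R =
    Min ((\<lambda>f. Max ((\<lambda>A. \<bar>\<Sum>x\<in>A \<inter> X. f x\<bar>) ` R)) ` (X \<rightarrow>\<^sub>E {-1, 1}))"

definition hyperplanes :: "'a::euclidean_space set set" where
  "hyperplanes = {H. \<exists>a b. a \<noteq> 0 \<and> H = {x. a \<bullet> x = b}}"

lemma finite_disc_values: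
  fixes f :: "'a \<Rightarrow> int"
  assumes "finite X"
  shows "finite ((\<lambda>A. \<bar>\<Sum>x\<in>A \<inter> X. f x\<bar>) ` R)"
proof (rule finite_subset)
  show "(\<lambda>A. \<bar>\<Sum>x\<in>A \<inter> X. f x\<bar>) ` R \<subseteq> (\<lambda>B. \<bar>\<Sum>x\<in>B. f x\<bar>) ` Pow X"
    by auto
  show "finite ((\<lambda>B. \<bar>\<Sum>x\<in>B. f x\<bar>) ` Pow X)"
    using assms by simp
qed

lemma le_disc_iff:
  assumes "finite X" "R \<noteq> {}"
  shows "k \<le> disc X R \<longleftrightarrow>
    (\<forall>f\<in>X \<rightarrow>\<^sub>E {-1, 1}. \<exists>A\<in>R. k \<le> \<bar>\<Sum>x\<in>A \<inter> X. f x\<bar>)"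
proof -
  have "finite (X \<rightarrow>\<^sub>E {-1, 1 :: int})" "X \<rightarrow>\<^sub>E {-1, 1 :: int} \<noteq> {}"
    using assms by (auto intro: finite_PiE simp: PiE_eq_empty_iff)
  then show ?thesis
    using finite_disc_values[OF assms(1)] assms(2)
    by (simp add: disc_def Min_ge_iff Max_ge_iff)
qed

end

theory Submission
  imports Defs
begin

text \<open>
  Write \<open>r = d - 1\<close> and take a grid of points \<open>(x, z)\<close> with \<open>x \<in> [s]\<^sup>r\<close>, \<open>z \<in> [L]\<close>, where \<open>L\<close> is of
  order \<open>s\<^sup>2\<close>, and the hyperplanes \<open>z = c \<bullet> x + b\<close> with \<open>c = a - a'\<close>, \<open>a, a' \<in> [D]\<^sup>r\<close>, where \<open>D\<close> is a
  large multiple of \<open>s\<close>. A Fourier transform modulo \<open>N = 2 L\<close> in the variable \<open>z\<close> turns the sum of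
  the squared hyperplane sums of \<open>f\<close> into a sum over frequencies \<open>t\<close> of quadratic forms in
  \<open>x \<mapsto> F(x, t)\<close>, the kernel of which is a product of Fejer kernels. These are nonnegative and
  Parseval gives their mean over \<open>t\<close>, so the kernel is diagonally dominant unless \<open>t\<close> lies in a set
  of few bad frequencies.

  The bad frequencies are handled by passing to a subset of the grid. If every subset \<open>Y\<close> had a
  colouring with small hyperplane sums, then rounding the bad Fourier coefficients of these
  colourings and counting would give two subsets far apart in Hamming distance whose colourings
  almost agree at all bad frequencies. The difference of the two colourings has most of its energy
  at good frequencies, so some hyperplane sum is of order \<open>s\<^bsup>r/2\<^esup>\<close>, which is \<open>n\<^bsup>1/2 - 1/(d+1)\<^esup>\<close> up
  to a constant. Adding points off finitely many hyperplanes does not decrease the discrepancy, so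
  every cardinality is reached; no logarithm is lost.
\<close>

subsection \<open>Characters modulo N\<close>

definition root_char :: "nat \<Rightarrow> int \<Rightarrow> complex" where
  "root_char N j = cis (2 * pi * real_of_int j / real N)"

lemma root_char_add: "root_char N (i + j) = root_char N i * root_char N j"
  by (simp add: root_char_def cis_mult add_divide_distrib ring_distribs)

lemma root_char_0 [simp]: "root_char N 0 = 1"
  by (simp add: root_char_def)

lemma cnj_root_char: "cnj (root_char N j) = root_char N (- j)"
  by (simp add: root_char_def cis_cnj)

lemma norm_root_char [simp]: "cmod (root_char N j) = 1"
  by (simp add: root_char_def)

lemma root_char_sum: "finite J \<Longrightarrow> root_char N (\<Sum>j\<in>J. g j) = (\<Prod>j\<in>J. root_char N (g j))"
  by (induction rule: finite_induct) (simp_all add: root_char_add)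

lemma root_char_eq_1_iff:
  assumes "N > 0"
  shows "root_char N j = 1 \<longleftrightarrow> int N dvd j"
proof
  assume "root_char N j = 1"
  then have "cos (2 * pi * real_of_int j / real N) = 1"
    by (metis root_char_def cis.simps(1) one_complex.simps(1))
  then obtain n :: int where "2 * pi * real_of_int j / real N = real_of_int n * 2 * pi"
    unfolding cos_one_2pi_int by auto
  then have "real_of_int j = real_of_int (n * int N)"
    using assms by (simp add: field_simps)
  then have "j = n * int N"
    using of_int_eq_iff by blast
  then show "int N dvd j" by simp
next
  assume "int N dvd j"
  then obtain n where "j = int N * n" by blast
  then have "2 * pi * real_of_int j / real N = 2 * pi * real_of_int n"
    using assms by simp
  then show "root_char N j = 1"
    unfolding root_char_def by (simp only: cis_multiple_2pi Ints_of_int)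
qed

lemma root_char_orthogonality:
  assumes "N > 0"
  shows "(\<Sum>t<N. root_char N (int t * j)) = (if int N dvd j then of_nat N else 0)"
proof -
  have pow: "root_char N (int t * j) = root_char N j ^ t" for t
    by (induction t) (simp_all add: root_char_add ring_distribs)
  show ?thesis
  proof (cases "int N dvd j")
    case True
    then have "root_char N j = 1" using assms by (simp add: root_char_eq_1_iff)
    then have "(\<Sum>t<N. root_char N (int t * j)) = (\<Sum>t<N. 1)"
      by (intro sum.cong refl) (simp add: pow)
    then show ?thesis using True by simp
  next
    case False
    have "root_char N j ^ N = 1"
      using assms root_char_eq_1_iff[of N "int N * j"] by (simp flip: pow)
    moreover have "root_char N j \<noteq> 1"
      using False assms by (simp add: root_char_eq_1_iff)
    ultimately show ?thesis
      using False by (simp add: pow geometric_sum)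
  qed
qed

lemma parseval:
  fixes g :: "'i \<Rightarrow> real" and p :: "'i \<Rightarrow> int"
  assumes "N > 0" "finite S"
    and inj: "\<And>i j. i \<in> S \<Longrightarrow> j \<in> S \<Longrightarrow> int N dvd p i - p j \<Longrightarrow> i = j"
  shows "(\<Sum>t<N. (cmod (\<Sum>i\<in>S. g i * root_char N (int t * p i)))\<^sup>2) = real N * (\<Sum>i\<in>S. (g i)\<^sup>2)"
proof -
  have "complex_of_real (\<Sum>t<N. (cmod (\<Sum>i\<in>S. g i * root_char N (int t * p i)))\<^sup>2)
      = (\<Sum>t<N. \<Sum>i\<in>S. \<Sum>j\<in>S. g i * g j * root_char N (int t * (p i - p j)))"
  proof -
    have "root_char N (int t * (p i - p j)) = root_char N (int t * p i) * cnj (root_char N (int t * p j))" for t i j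
      by (simp add: cnj_root_char right_diff_distrib flip: root_char_add)
    then show ?thesis
      unfolding of_real_sum complex_norm_square cnj_sum sum_product
      by (intro sum.cong refl) (simp add: mult_ac)
  qed
  also have "\<dots> = (\<Sum>i\<in>S. \<Sum>j\<in>S. g i * g j * (\<Sum>t<N. root_char N (int t * (p i - p j))))"
    by (subst sum.swap, rule sum.cong[OF refl], subst sum.swap) (simp add: sum_distrib_left)
  also have "\<dots> = (\<Sum>i\<in>S. \<Sum>j\<in>S. if i = j then complex_of_real (g i * g j) * of_nat N else 0)"
    unfolding root_char_orthogonality[OF assms(1)]
    by (intro sum.cong refl) (use inj in auto)
  also have "\<dots> = complex_of_real (real N * (\<Sum>i\<in>S. (g i)\<^sup>2))"
    using assms(2) by (simp add: sum_distrib_left power2_eq_square mult_ac)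
  finally show ?thesis
    using of_real_eq_iff by blast
qed

lemma quadratic_form_lower_bound:
  fixes k :: "'i \<Rightarrow> 'i \<Rightarrow> real" and F :: "'i \<Rightarrow> complex"
  assumes "finite I"
    and nonneg: "\<And>x y. x \<in> I \<Longrightarrow> y \<in> I \<Longrightarrow> k x y \<ge> 0"
    and sym: "\<And>x y. x \<in> I \<Longrightarrow> y \<in> I \<Longrightarrow> k x y = k y x"
    and diag: "\<And>x. x \<in> I \<Longrightarrow> k x x = k0"
    and row: "\<And>x. x \<in> I \<Longrightarrow> (\<Sum>y\<in>I. k x y) \<le> 3 / 2 * k0"
  shows "k0 / 2 * (\<Sum>x\<in>I. (cmod (F x))\<^sup>2) \<le> Re (\<Sum>x\<in>I. \<Sum>y\<in>I. k x y * (F x * cnj (F y)))"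
proof -
  have re: "- ((cmod v)\<^sup>2 + (cmod w)\<^sup>2) / 2 \<le> Re (v * cnj w)" for v w
  proof -
    have "\<bar>Re (v * cnj w)\<bar> \<le> cmod v * cmod w"
      using abs_Re_le_cmod[of "v * cnj w"] by (simp add: norm_mult)
    then show ?thesis
      using sum_squares_bound[of "cmod v" "cmod w"] by (simp add: power2_eq_square)
  qed
  have pt: "(if x = y then 2 * k0 * (cmod (F x))\<^sup>2 else 0)
      - k x y * (cmod (F x))\<^sup>2 / 2 - k x y * (cmod (F y))\<^sup>2 / 2 \<le> Re (k x y * (F x * cnj (F y)))"
    if "x \<in> I" "y \<in> I" for x y
  proof (cases "x = y")
    case True
    then show ?thesis using that diag
      by (simp add: complex_norm_square[symmetric] flip: of_real_mult)
  next
    case False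
    then show ?thesis
      using mult_left_mono[OF re[of "F x" "F y"] nonneg[OF that]]
      by (simp add: algebra_simps add_divide_distrib)
  qed
  have a: "(\<Sum>x\<in>I. \<Sum>y\<in>I. k x y * (cmod (F x))\<^sup>2 / 2) \<le> (\<Sum>x\<in>I. 3 / 4 * k0 * (cmod (F x))\<^sup>2)"
  proof (rule sum_mono)
    fix x assume "x \<in> I"
    have "(\<Sum>y\<in>I. k x y * (cmod (F x))\<^sup>2 / 2) = (\<Sum>y\<in>I. k x y) * ((cmod (F x))\<^sup>2 / 2)"
      by (simp add: sum_distrib_right)
    also have "\<dots> \<le> 3 / 2 * k0 * ((cmod (F x))\<^sup>2 / 2)"
      by (rule mult_right_mono) (use row \<open>x \<in> I\<close> in auto)
    finally show "(\<Sum>y\<in>I. k x y * (cmod (F x))\<^sup>2 / 2) \<le> 3 / 4 * k0 * (cmod (F x))\<^sup>2"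
      by simp
  qed
  have b: "(\<Sum>x\<in>I. \<Sum>y\<in>I. k x y * (cmod (F y))\<^sup>2 / 2) = (\<Sum>x\<in>I. \<Sum>y\<in>I. k x y * (cmod (F x))\<^sup>2 / 2)"
    by (subst sum.swap, intro sum.cong refl) (use sym in auto)
  have "(\<Sum>x\<in>I. 2 * k0 * (cmod (F x))\<^sup>2) - (\<Sum>x\<in>I. \<Sum>y\<in>I. k x y * (cmod (F x))\<^sup>2 / 2)
       - (\<Sum>x\<in>I. \<Sum>y\<in>I. k x y * (cmod (F y))\<^sup>2 / 2)
     = (\<Sum>x\<in>I. \<Sum>y\<in>I. (if x = y then 2 * k0 * (cmod (F x))\<^sup>2 else 0)
        - k x y * (cmod (F x))\<^sup>2 / 2 - k x y * (cmod (F y))\<^sup>2 / 2)"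
    using assms(1) by (simp add: sum_subtractf)
  also have "\<dots> \<le> Re (\<Sum>x\<in>I. \<Sum>y\<in>I. k x y * (F x * cnj (F y)))"
    unfolding Re_sum by (intro sum_mono pt)
  finally show ?thesis
    using a b unfolding sum_distrib_left[symmetric] by linarith
qed

subsection \<open>Counting subsets with equal rounded coordinates\<close>

lemma card_set_family_near:
  assumes "finite G" "S \<subseteq> G"
  shows "real (card {T \<in> Pow G. card (sym_diff S T) \<le> h}) \<le> 4 ^ h * (5 / 4) ^ card G"
proof -
  let ?B = "{T \<in> Pow G. card (sym_diff S T) \<le> h}"
  have inj: "inj_on (sym_diff S) ?B" by (rule inj_onI) blast
  have img: "sym_diff S ` ?B \<subseteq> Pow G" using assms by auto
  have "real (card ?B) * (1 / 4) ^ h = (\<Sum>T\<in>?B. (1 / 4) ^ h)" by simp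
  also have "\<dots> \<le> (\<Sum>T\<in>?B. (1 / 4 :: real) ^ card (sym_diff S T))"
    by (rule sum_mono) (auto intro: power_decreasing)
  also have "\<dots> = (\<Sum>T\<in>sym_diff S ` ?B. (1 / 4) ^ card T)"
    using inj by (simp add: sum.reindex)
  also have "\<dots> \<le> (\<Sum>T\<in>Pow G. (1 / 4) ^ card T)"
    using img assms by (intro sum_mono2) auto
  also have "\<dots> = (\<Prod>x\<in>G. 1 / 4 + 1)"
    using assms by (subst prod_add) simp_all
  finally show ?thesis by (simp add: field_simps)
qed

lemma sum_geometric_abs_le:
  fixes q :: real
  assumes "0 < q" "q < 1"
  shows "(\<Sum>c\<in>{-int M..int M}. q ^ nat \<bar>c\<bar>) \<le> (1 + q) / (1 - q)"
proof -
  have "(\<Sum>c\<in>{-int M..int M}. q ^ nat \<bar>c\<bar>) = 1 + 2 * (\<Sum>m<M. q ^ Suc m)"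
  proof (induction M)
    case (Suc M)
    have "{-int (Suc M)..int (Suc M)} = insert (int (Suc M)) (insert (- int (Suc M)) {-int M..int M})"
      by auto
    moreover have "nat \<bar>int (Suc M)\<bar> = Suc M" "nat \<bar>- int (Suc M)\<bar> = Suc M"
      by simp_all
    ultimately show ?case
      using Suc by (simp del: of_nat_Suc power_Suc)
  qed simp
  also have "(\<Sum>m<M. q ^ Suc m) = q * ((1 - q ^ M) / (1 - q))"
    using assms by (simp add: sum_distrib_left[symmetric] geometric_sum field_simps)
  also have "\<dots> \<le> q * (1 / (1 - q))"
    using assms by (intro mult_left_mono divide_right_mono) auto
  finally show ?thesis using assms by (simp add: field_simps)
qed

lemma card_integer_l1_ball_le:
  assumes "finite K" and fin: "finite C"
    and ext: "\<And>c. c \<in> C \<Longrightarrow> c \<in> extensional K"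
    and le: "\<And>c. c \<in> C \<Longrightarrow> (\<Sum>j\<in>K. \<bar>c j\<bar>) \<le> int R"
    and q: "0 < q" "q < 1"
  shows "real (card C) * q ^ R \<le> ((1 + q) / (1 - q)) ^ card K"
proof -
  have abs_le: "\<bar>c j\<bar> \<le> int R" if "c \<in> C" "j \<in> K" for c j
    using member_le_sum[of j K "\<lambda>j. \<bar>c j\<bar>"] that assms(1) le[of c] by force
  have sub: "C \<subseteq> K \<rightarrow>\<^sub>E {-int R..int R}"
  proof
    fix c assume c: "c \<in> C"
    show "c \<in> K \<rightarrow>\<^sub>E {-int R..int R}"
    proof (rule PiE_I)
      fix j assume "j \<in> K"
      then show "c j \<in> {-int R..int R}" using abs_le[OF c, of j] by auto
    next
      fix j assume "j \<notin> K"
      then show "c j = undefined" using ext[OF c] by (rule extensional_arb[rotated])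
    qed
  qed
  have "real (card C) * q ^ R = (\<Sum>c\<in>C. q ^ R)" by simp
  also have "\<dots> \<le> (\<Sum>c\<in>C. \<Prod>j\<in>K. q ^ nat \<bar>c j\<bar>)"
  proof (rule sum_mono)
    fix c assume "c \<in> C"
    have "(\<Prod>j\<in>K. q ^ nat \<bar>c j\<bar>) = q ^ (\<Sum>j\<in>K. nat \<bar>c j\<bar>)"
      by (simp add: power_sum)
    moreover have "(\<Sum>j\<in>K. nat \<bar>c j\<bar>) \<le> R"
      using le[OF \<open>c \<in> C\<close>] by (simp flip: of_nat_le_iff[where 'a=int])
    ultimately show "q ^ R \<le> (\<Prod>j\<in>K. q ^ nat \<bar>c j\<bar>)"
      using q by (simp add: power_decreasing)
  qed
  also have "\<dots> \<le> (\<Sum>c\<in>K \<rightarrow>\<^sub>E {-int R..int R}. \<Prod>j\<in>K. q ^ nat \<bar>c j\<bar>)"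
    using sub assms(1) q by (intro sum_mono2 finite_PiE) (auto intro!: prod_nonneg)
  also have "\<dots> = (\<Prod>j\<in>K. \<Sum>c\<in>{-int R..int R}. q ^ nat \<bar>c\<bar>)"
    using assms(1) by (subst prod_sum_PiE) simp_all
  also have "\<dots> \<le> (\<Prod>j\<in>K. (1 + q) / (1 - q))"
    using q by (intro prod_mono conjI sum_geometric_abs_le sum_nonneg) auto
  finally show ?thesis by simp
qed

text \<open>Pigeonhole: some fibre of \<open>\<Phi>\<close> is too large to fit into a Hamming ball of radius \<open>card G / 32\<close>.\<close>
lemma exists_far_subsets_same_rounding:
  fixes \<Phi> :: "'a set \<Rightarrow> 'k \<Rightarrow> int"
  assumes "finite G" "G \<noteq> {}" "finite K"
    and K: "64 * card K \<le> card G"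
    and ext: "\<And>T. T \<subseteq> G \<Longrightarrow> \<Phi> T \<in> extensional K"
    and le: "\<And>T. T \<subseteq> G \<Longrightarrow> (\<Sum>j\<in>K. \<bar>\<Phi> T j\<bar>) \<le> 2 * int (card G)"
  shows "\<exists>S T. S \<subseteq> G \<and> T \<subseteq> G \<and> \<Phi> S = \<Phi> T \<and> card G < 32 * card (sym_diff S T)"
proof (rule ccontr)
  assume neg: "\<not> ?thesis"
  have near: "32 * card (sym_diff S T) \<le> card G" if "S \<subseteq> G" "T \<subseteq> G" "\<Phi> S = \<Phi> T" for S T
  proof (rule ccontr)
    assume "\<not> 32 * card (sym_diff S T) \<le> card G"
    then have "card G < 32 * card (sym_diff S T)" by simp
    with that neg show False by blast
  qed
  define n where "n = card G"
  define C where "C = \<Phi> ` Pow G"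
  have "real (card C) * (9 / 10) ^ (2 * n) \<le> ((1 + 9 / 10) / (1 - 9 / 10)) ^ card K"
    using assms(1,3) ext le by (intro card_integer_l1_ball_le) (auto simp: C_def n_def)
  moreover have "(9 / 10 :: real) ^ (2 * n) = (81 / 100) ^ n"
    by (simp only: power_mult) (simp add: power2_eq_square)
  moreover have "(1 + 9 / 10) / (1 - 9 / 10) = (19 :: real)" by simp
  ultimately have "real (card C) * (81 / 100) ^ n \<le> 19 ^ card K"
    by (simp only:)
  then have C: "real (card C) \<le> 19 ^ card K * (100 / 81) ^ n"
    by (simp add: field_simps)
  have fibre: "real (card {T \<in> Pow G. \<Phi> T = c}) \<le> 4 ^ (n div 32) * (5 / 4) ^ n" if "c \<in> C" for c
  proof -
    obtain S where S: "S \<subseteq> G" "c = \<Phi> S" using \<open>c \<in> C\<close> by (auto simp: C_def)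
    have "{T \<in> Pow G. \<Phi> T = c} \<subseteq> {T \<in> Pow G. card (sym_diff S T) \<le> n div 32}"
    proof
      fix T assume T: "T \<in> {T \<in> Pow G. \<Phi> T = c}"
      then have "32 * card (sym_diff S T) \<le> n"
        using near[OF S(1), of T] S(2) by (simp add: n_def)
      then have "card (sym_diff S T) \<le> n div 32" by linarith
      then show "T \<in> {T \<in> Pow G. card (sym_diff S T) \<le> n div 32}" using T by simp
    qed
    then have "card {T \<in> Pow G. \<Phi> T = c} \<le> card {T \<in> Pow G. card (sym_diff S T) \<le> n div 32}"
      using assms(1) by (intro card_mono) auto
    then show ?thesis
      using card_set_family_near[OF assms(1) S(1), of "n div 32"] by (simp add: n_def)
  qed
  have "real (card (Pow G)) = (\<Sum>c\<in>C. real (card {T \<in> Pow G. \<Phi> T = c}))"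
    using sum.image_gen[of "Pow G" "\<lambda>_. 1::real" \<Phi>] assms(1) by (simp add: C_def)
  also have "\<dots> \<le> (\<Sum>c\<in>C. 4 ^ (n div 32) * (5 / 4) ^ n)"
    by (intro sum_mono fibre)
  also have "\<dots> = real (card C) * (4 ^ (n div 32) * (5 / 4) ^ n)" by simp
  also have "\<dots> \<le> (19 ^ card K * (100 / 81) ^ n) * (4 ^ (n div 32) * (5 / 4) ^ n)"
    by (intro mult_right_mono C) auto
  also have "\<dots> \<le> ((61 / 50) ^ n * (100 / 81) ^ n) * ((21 / 20) ^ n * (5 / 4) ^ n)"
  proof (intro mult_mono order_refl)
    have "(19::real) ^ card K \<le> ((61 / 50) ^ 16) ^ card K" by (rule power_mono) (simp_all add: power_divide)
    also have "\<dots> = (61 / 50) ^ (16 * card K)" by (simp add: power_mult)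
    also have "\<dots> \<le> (61 / 50) ^ n" using K by (intro power_increasing) (auto simp: n_def)
    finally show "(19::real) ^ card K \<le> (61 / 50) ^ n" .
    have "(4::real) ^ (n div 32) \<le> ((21 / 20) ^ 32) ^ (n div 32)" by (rule power_mono) (simp_all add: power_divide)
    also have "\<dots> = (21 / 20) ^ (32 * (n div 32))" by (simp add: power_mult)
    also have "\<dots> \<le> (21 / 20) ^ n" by (intro power_increasing) auto
    finally show "(4::real) ^ (n div 32) \<le> (21 / 20) ^ n" .
  qed auto
  also have "\<dots> = (61 / 50 * (100 / 81) * (21 / 20 * (5 / 4))) ^ n"
    by (simp only: power_mult_distrib)
  also have "\<dots> < 2 ^ n"
    using assms(1,2) by (intro power_strict_mono) (auto simp: n_def card_gt_0_iff)
  also have "\<dots> = real (card (Pow G))"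
    using assms(1) by (simp add: card_Pow n_def)
  finally show False by simp
qed

subsection \<open>Diagonal dominance at good frequencies\<close>

definition int_cube :: "'j set \<Rightarrow> nat \<Rightarrow> ('j \<Rightarrow> int) set" where
  "int_cube J s = J \<rightarrow>\<^sub>E {0..<int s}"

definition idot :: "'j set \<Rightarrow> ('j \<Rightarrow> int) \<Rightarrow> ('j \<Rightarrow> int) \<Rightarrow> int" where
  "idot J a x = (\<Sum>j\<in>J. a j * x j)"

definition fejer :: "nat \<Rightarrow> nat \<Rightarrow> nat \<Rightarrow> int \<Rightarrow> real" where
  "fejer N D t v = (cmod (\<Sum>u\<in>{0..<int D}. root_char N (int t * (u * v))))\<^sup>2"

definition bad_freqs :: "nat \<Rightarrow> nat \<Rightarrow> nat \<Rightarrow> real \<Rightarrow> nat set" where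
  "bad_freqs N D s \<epsilon> = {t. t < N \<and> \<epsilon> * (real D)\<^sup>2 < (\<Sum>v\<in>{- int s<..<int s} - {0}. fejer N D t v)}"

lemma finite_int_cube [simp]: "finite J \<Longrightarrow> finite (int_cube J s)"
  by (simp add: int_cube_def finite_PiE)

lemma card_int_cube: "finite J \<Longrightarrow> card (int_cube J s) = s ^ card J"
  by (simp add: int_cube_def card_PiE)

lemma fejer_nonneg [simp]: "fejer N D t v \<ge> 0"
  by (simp add: fejer_def)

lemma fejer_0 [simp]: "fejer N D t 0 = (real D)\<^sup>2"
  by (simp add: fejer_def)

lemma fejer_minus: "fejer N D t (- v) = fejer N D t v"
proof -
  have "(\<Sum>u\<in>{0..<int D}. root_char N (int t * (u * - v)))
      = cnj (\<Sum>u\<in>{0..<int D}. root_char N (int t * (u * v)))"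
    by (simp add: cnj_root_char)
  then show ?thesis by (simp only: fejer_def complex_mod_cnj)
qed

lemma sum_fejer:
  assumes "D * s \<le> N" "v \<in> {- int s<..<int s} - {0}"
  shows "(\<Sum>t<N. fejer N D t v) = real N * real D"
proof (cases "D = 0")
  case False
  have "s > 0" using assms(2) by auto
  with False assms(1) have "N > 0" by (metis gr0I le_zero_eq mult_is_0)
  have "u = u'" if "u \<in> {0..<int D}" "u' \<in> {0..<int D}" "int N dvd u * v - u' * v" for u u'
  proof -
    have "\<bar>u - u'\<bar> * \<bar>v\<bar> < int D * int s"
      using that(1,2) assms(2) by (intro mult_strict_mono) auto
    also have "\<dots> \<le> int N"
      using assms(1) by (metis of_nat_le_iff of_nat_mult)
    finally have "\<bar>u * v - u' * v\<bar> < int N"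
      by (simp add: abs_mult flip: left_diff_distrib)
    then have "u * v - u' * v = 0"
      using that(3) zdvd_imp_le[of "int N" "\<bar>u * v - u' * v\<bar>"] by fastforce
    then show ?thesis using assms(2) by simp
  qed
  then show ?thesis
    using parseval[OF \<open>N > 0\<close>, of "{0..<int D}" "\<lambda>u. u * v" "\<lambda>_. 1"]
    by (simp add: fejer_def)
qed (simp add: fejer_def)

lemma card_bad_freqs:
  assumes "D * s \<le> N" "\<epsilon> \<ge> 0" "D > 0"
  shows "real (card (bad_freqs N D s \<epsilon>)) * (\<epsilon> * real D) \<le> 2 * real s * real N"
proof -
  let ?V = "{- int s<..<int s} - {0}" and ?B = "bad_freqs N D s \<epsilon>"
  have B: "?B \<subseteq> {..<N}" by (auto simp: bad_freqs_def)
  have "real (card ?B) * (\<epsilon> * (real D)\<^sup>2) = (\<Sum>t\<in>?B. \<epsilon> * (real D)\<^sup>2)" by simp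
  also have "\<dots> \<le> (\<Sum>t\<in>?B. \<Sum>v\<in>?V. fejer N D t v)"
    by (rule sum_mono) (simp add: bad_freqs_def)
  also have "\<dots> \<le> (\<Sum>t<N. \<Sum>v\<in>?V. fejer N D t v)"
    using B by (intro sum_mono2) (auto intro: sum_nonneg)
  also have "\<dots> = (\<Sum>v\<in>?V. real N * real D)"
    by (subst sum.swap, rule sum.cong[OF refl]) (rule sum_fejer[OF assms(1)])
  also have "\<dots> \<le> 2 * real s * (real N * real D)"
  proof -
    have "card ?V \<le> card {- int s<..<int s}" by (intro card_mono) auto
    also have "\<dots> \<le> 2 * s" by simp
    finally have "real (card ?V) \<le> 2 * real s" by linarith
    then show ?thesis by (simp add: mult_right_mono del: card_Diff_insert)
  qed
  finally show ?thesis
    using assms(3) by (simp add: power2_eq_square)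
qed

lemma sum_root_char_idot:
  assumes "finite J"
  shows "(\<Sum>a\<in>int_cube J D. root_char N (int t * idot J a w))
    = (\<Prod>j\<in>J. \<Sum>u\<in>{0..<int D}. root_char N (int t * (u * w j)))"
  using assms by (subst prod_sum_PiE) (simp_all add: idot_def sum_distrib_left root_char_sum int_cube_def)

lemma sum_swap_pairs:
  "(\<Sum>a\<in>A. \<Sum>b\<in>B. \<Sum>x\<in>X. \<Sum>y\<in>Y. g a b x y) = (\<Sum>x\<in>X. \<Sum>y\<in>Y. \<Sum>a\<in>A. \<Sum>b\<in>B. g a b x y)"
proof -
  have "(\<Sum>a\<in>A. \<Sum>b\<in>B. \<Sum>x\<in>X. \<Sum>y\<in>Y. g a b x y) = (\<Sum>a\<in>A. \<Sum>x\<in>X. \<Sum>b\<in>B. \<Sum>y\<in>Y. g a b x y)"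
    by (rule sum.cong[OF refl], rule sum.swap)
  also have "\<dots> = (\<Sum>x\<in>X. \<Sum>a\<in>A. \<Sum>b\<in>B. \<Sum>y\<in>Y. g a b x y)"
    by (rule sum.swap)
  also have "\<dots> = (\<Sum>x\<in>X. \<Sum>a\<in>A. \<Sum>y\<in>Y. \<Sum>b\<in>B. g a b x y)"
    by (rule sum.cong[OF refl], rule sum.cong[OF refl], rule sum.swap)
  also have "\<dots> = (\<Sum>x\<in>X. \<Sum>y\<in>Y. \<Sum>a\<in>A. \<Sum>b\<in>B. g a b x y)"
    by (rule sum.cong[OF refl], rule sum.swap)
  finally show ?thesis .
qed

lemma energy_kernel:
  fixes F :: "('j \<Rightarrow> int) \<Rightarrow> complex"
  assumes "finite J"
  shows "complex_of_real (\<Sum>a\<in>int_cube J D. \<Sum>a'\<in>int_cube J D.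
      (cmod (\<Sum>x\<in>X. root_char N (int t * idot J (\<lambda>j. a' j - a j) x) * F x))\<^sup>2)
    = (\<Sum>x\<in>X. \<Sum>y\<in>X. (\<Prod>j\<in>J. fejer N D t (x j - y j)) * (F x * cnj (F y)))"
proof -
  define E where "E a w = root_char N (int t * idot J a w)" for a w
  let ?A = "int_cube J D"
  have split: "root_char N (int t * idot J (\<lambda>j. a' j - a j) x) * cnj (root_char N (int t * idot J (\<lambda>j. a' j - a j) y))
      = E a' (\<lambda>j. x j - y j) * cnj (E a (\<lambda>j. x j - y j))" for a a' x y
  proof -
    have "int t * idot J (\<lambda>j. a' j - a j) x - int t * idot J (\<lambda>j. a' j - a j) y
      = int t * idot J a' (\<lambda>j. x j - y j) - int t * idot J a (\<lambda>j. x j - y j)"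
      unfolding idot_def right_diff_distrib[symmetric] sum_subtractf[symmetric]
      by (simp add: algebra_simps)
    then show ?thesis
      by (simp add: E_def cnj_root_char flip: root_char_add)
  qed
  have square: "complex_of_real ((cmod (\<Sum>x\<in>X. w x * F x))\<^sup>2)
      = (\<Sum>x\<in>X. \<Sum>y\<in>X. (w x * cnj (w y)) * (F x * cnj (F y)))" for w
    unfolding complex_norm_square cnj_sum sum_product
    by (intro sum.cong refl) (simp add: mult_ac)
  have factor: "(\<Sum>a\<in>?A. \<Sum>a'\<in>?A. e a' * cnj (e a) * c) = (\<Sum>a'\<in>?A. e a') * cnj (\<Sum>a\<in>?A. e a) * c"
    for e :: "('j \<Rightarrow> int) \<Rightarrow> complex" and c
    unfolding cnj_sum sum_product
    unfolding sum_distrib_right by (rule sum.swap)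
  have "complex_of_real (\<Sum>a\<in>?A. \<Sum>a'\<in>?A.
      (cmod (\<Sum>x\<in>X. root_char N (int t * idot J (\<lambda>j. a' j - a j) x) * F x))\<^sup>2)
    = (\<Sum>a\<in>?A. \<Sum>a'\<in>?A. \<Sum>x\<in>X. \<Sum>y\<in>X.
        (E a' (\<lambda>j. x j - y j) * cnj (E a (\<lambda>j. x j - y j))) * (F x * cnj (F y)))"
    unfolding of_real_sum square split by (rule refl)
  also have "\<dots> = (\<Sum>x\<in>X. \<Sum>y\<in>X. \<Sum>a\<in>?A. \<Sum>a'\<in>?A.
        (E a' (\<lambda>j. x j - y j) * cnj (E a (\<lambda>j. x j - y j))) * (F x * cnj (F y)))"
    by (rule sum_swap_pairs)
  also have "\<dots> = (\<Sum>x\<in>X. \<Sum>y\<in>X.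
        ((\<Sum>a'\<in>?A. E a' (\<lambda>j. x j - y j)) * cnj (\<Sum>a\<in>?A. E a (\<lambda>j. x j - y j))) * (F x * cnj (F y)))"
    by (intro sum.cong refl factor)
  also have "\<dots> = (\<Sum>x\<in>X. \<Sum>y\<in>X. (\<Prod>j\<in>J. fejer N D t (x j - y j)) * (F x * cnj (F y)))"
    unfolding complex_norm_square[symmetric] E_def sum_root_char_idot[OF assms] fejer_def
    by (simp add: prod_power_distrib flip: prod_norm)
  finally show ?thesis .
qed

lemma good_freq_energy:
  fixes F :: "('j \<Rightarrow> int) \<Rightarrow> complex"
  assumes "finite J" and t: "t < N" "t \<notin> bad_freqs N D s \<epsilon>"
    and \<epsilon>: "\<epsilon> \<ge> 0" "(1 + \<epsilon>) ^ card J \<le> 3 / 2"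
  shows "(real D) ^ (2 * card J) / 2 * (\<Sum>x\<in>int_cube J s. (cmod (F x))\<^sup>2)
    \<le> (\<Sum>a\<in>int_cube J D. \<Sum>a'\<in>int_cube J D.
      (cmod (\<Sum>x\<in>int_cube J s. root_char N (int t * idot J (\<lambda>j. a' j - a j) x) * F x))\<^sup>2)"
proof -
  let ?k = "\<lambda>x y. \<Prod>j\<in>J. fejer N D t (x j - y j)"
  let ?X = "int_cube J s"
  have one: "(\<Sum>v\<in>{0..<int s}. fejer N D t (c - v)) \<le> (real D)\<^sup>2 * (1 + \<epsilon>)" if "c \<in> {0..<int s}" for c
  proof -
    have "(\<Sum>v\<in>{0..<int s}. fejer N D t (c - v)) = (\<Sum>w\<in>(\<lambda>v. c - v) ` {0..<int s}. fejer N D t w)"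
      by (subst sum.reindex) (simp_all add: inj_on_def)
    also have "\<dots> \<le> (\<Sum>w\<in>insert 0 ({- int s<..<int s} - {0}). fejer N D t w)"
      using that by (intro sum_mono2) auto
    also have "\<dots> = (real D)\<^sup>2 + (\<Sum>w\<in>{- int s<..<int s} - {0}. fejer N D t w)"
      by (subst sum.insert) auto
    also have "\<dots> \<le> (real D)\<^sup>2 + \<epsilon> * (real D)\<^sup>2"
      using t by (simp add: bad_freqs_def not_less)
    finally show ?thesis by (simp add: algebra_simps)
  qed
  have "(real D) ^ (2 * card J) / 2 * (\<Sum>x\<in>?X. (cmod (F x))\<^sup>2)
    \<le> Re (\<Sum>x\<in>?X. \<Sum>y\<in>?X. ?k x y * (F x * cnj (F y)))"
  proof (rule quadratic_form_lower_bound)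
    fix x y
    show "0 \<le> ?k x y" by (simp add: prod_nonneg)
    show "?k x y = ?k y x"
      by (rule prod.cong[OF refl]) (metis fejer_minus minus_diff_eq)
    show "?k x x = (real D) ^ (2 * card J)" by (simp add: power_mult)
  next
    fix x assume x: "x \<in> ?X"
    have "(\<Sum>y\<in>?X. ?k x y) = (\<Prod>j\<in>J. \<Sum>v\<in>{0..<int s}. fejer N D t (x j - v))"
      using assms(1) by (subst prod_sum_PiE) (simp_all add: int_cube_def)
    also have "\<dots> \<le> (\<Prod>j\<in>J. (real D)\<^sup>2 * (1 + \<epsilon>))"
      using x one by (intro prod_mono conjI sum_nonneg) (auto simp: int_cube_def PiE_iff)
    also have "\<dots> = (1 + \<epsilon>) ^ card J * (real D) ^ (2 * card J)"
      by (simp add: power_mult power_mult_distrib)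
    also have "\<dots> \<le> 3 / 2 * (real D) ^ (2 * card J)"
      by (rule mult_right_mono[OF \<epsilon>(2)]) simp
    finally show "(\<Sum>y\<in>?X. ?k x y) \<le> 3 / 2 * (real D) ^ (2 * card J)" .
  qed (use assms(1) in simp)
  then show ?thesis
    by (simp only: energy_kernel[OF assms(1), symmetric] Re_complex_of_real)
qed

subsection \<open>Energy of the hyperplane sums\<close>

definition plane_sum :: "'j set \<Rightarrow> (('j \<Rightarrow> int) \<times> int) set \<Rightarrow> (('j \<Rightarrow> int) \<times> int \<Rightarrow> real) \<Rightarrow> ('j \<Rightarrow> int) \<Rightarrow> int \<Rightarrow> real" where
  "plane_sum J G f c b = (\<Sum>p | p \<in> G \<and> snd p - idot J c (fst p) = b. f p)"

definition column_dft :: "nat \<Rightarrow> nat \<Rightarrow> ('k \<times> int \<Rightarrow> real) \<Rightarrow> 'k \<Rightarrow> nat \<Rightarrow> complex" where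
  "column_dft N L f x t = (\<Sum>z\<in>{0..<int L}. f (x, z) * root_char N (int t * z))"

lemma parseval_column_dft:
  assumes "L \<le> N" "N > 0"
  shows "(\<Sum>t<N. (cmod (column_dft N L f x t))\<^sup>2) = real N * (\<Sum>z\<in>{0..<int L}. (f (x, z))\<^sup>2)"
  unfolding column_dft_def
proof (rule parseval[OF assms(2)])
  fix i j assume "i \<in> {0..<int L}" "j \<in> {0..<int L}" "int N dvd i - j"
  then show "i = j"
    using assms(1) zdvd_imp_le[of "int N" "\<bar>i - j\<bar>"] by fastforce
qed simp

lemma parseval_grid:
  assumes "L \<le> N" "N > 0"
  shows "(\<Sum>t<N. \<Sum>x\<in>X. (cmod (column_dft N L f x t))\<^sup>2)
    = real N * (\<Sum>p\<in>X \<times> {0..<int L}. (f p)\<^sup>2)"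
  by (subst sum.swap) (simp add: parseval_column_dft[OF assms] sum.cartesian_product split_def
      sum_distrib_left[symmetric])

lemma parseval_plane_sum:
  fixes f :: "('j \<Rightarrow> int) \<times> int \<Rightarrow> real"
  assumes "finite X" "N > 0"
    and range: "\<And>x z. x \<in> X \<Longrightarrow> z \<in> {0..<int L} \<Longrightarrow> z - idot J c x \<in> {- K..<int N - K}"
  shows "real N * (\<Sum>b\<in>{- K..<int N - K}. (plane_sum J (X \<times> {0..<int L}) f c b)\<^sup>2)
    = (\<Sum>t<N. (cmod (\<Sum>x\<in>X. root_char N (int t * idot J (\<lambda>j. - c j) x) * column_dft N L f x t))\<^sup>2)"
proof -
  let ?G = "X \<times> {0..<int L}" and ?T = "{- K..<int N - K}"
  let ?g = "\<lambda>p. snd p - idot J c (fst p)"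
  have "real N * (\<Sum>b\<in>?T. (plane_sum J ?G f c b)\<^sup>2)
    = (\<Sum>t<N. (cmod (\<Sum>b\<in>?T. plane_sum J ?G f c b * root_char N (int t * b)))\<^sup>2)"
  proof (rule parseval[OF assms(2), symmetric])
    fix i j assume "i \<in> ?T" "j \<in> ?T" "int N dvd i - j"
    then show "i = j"
      using zdvd_imp_le[of "int N" "\<bar>i - j\<bar>"] by fastforce
  qed simp
  moreover have "(\<Sum>b\<in>?T. plane_sum J ?G f c b * root_char N (int t * b))
    = (\<Sum>x\<in>X. root_char N (int t * idot J (\<lambda>j. - c j) x) * column_dft N L f x t)" for t
  proof -
    have "(\<Sum>b\<in>?T. plane_sum J ?G f c b * root_char N (int t * b))
      = (\<Sum>b\<in>?T. \<Sum>p\<in>{p \<in> ?G. ?g p = b}. f p * root_char N (int t * ?g p))"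
      by (auto simp: plane_sum_def sum_distrib_right intro!: sum.cong)
    also have "\<dots> = (\<Sum>p\<in>?G. f p * root_char N (int t * ?g p))"
      using assms(1) range by (intro sum.group) auto
    also have "\<dots> = (\<Sum>x\<in>X. \<Sum>z\<in>{0..<int L}. f (x, z) * root_char N (int t * (z - idot J c x)))"
      by (simp add: sum.cartesian_product split_def)
    also have "\<dots> = (\<Sum>x\<in>X. root_char N (int t * idot J (\<lambda>j. - c j) x) * column_dft N L f x t)"
    proof -
      have "root_char N (int t * (z - idot J c x))
        = root_char N (int t * idot J (\<lambda>j. - c j) x) * root_char N (int t * z)" for z x
        by (simp add: idot_def sum_negf algebra_simps flip: root_char_add)
      then show ?thesis
        by (simp add: column_dft_def sum_distrib_left mult_ac)
    qed
    finally show ?thesis .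
  qed
  ultimately show ?thesis by simp
qed

lemma abs_idot_le:
  assumes "a \<in> int_cube J D" "a' \<in> int_cube J D" "x \<in> int_cube J s" 
  shows "\<bar>idot J (\<lambda>j. a j - a' j) x\<bar> \<le> int (card J * D * s)"
proof -
  have "\<bar>idot J (\<lambda>j. a j - a' j) x\<bar> \<le> (\<Sum>j\<in>J. \<bar>(a j - a' j) * x j\<bar>)"
    unfolding idot_def by (rule sum_abs)
  also have "\<dots> \<le> (\<Sum>j\<in>J. int D * int s)"
  proof (rule sum_mono)
    fix j assume "j \<in> J"
    then have "a j \<in> {0..<int D}" "a' j \<in> {0..<int D}" "x j \<in> {0..<int s}"
      using assms by (auto simp: int_cube_def PiE_iff)
    then show "\<bar>(a j - a' j) * x j\<bar> \<le> int D * int s"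
      unfolding abs_mult by (intro mult_mono) auto
  qed
  finally show ?thesis by simp
qed

lemma plane_sums_energy:
  fixes f :: "('j \<Rightarrow> int) \<times> int \<Rightarrow> real"
  assumes J: "finite J" and "D > 0" "L > 0"
    and N: "L + 2 * card J * D * s \<le> N"
    and \<epsilon>: "\<epsilon> \<ge> 0" "(1 + \<epsilon>) ^ card J \<le> 3 / 2"
    and bound: "\<And>c b. \<bar>plane_sum J (int_cube J s \<times> {0..<int L}) f c b\<bar> \<le> B"
  shows "real N * (\<Sum>p\<in>int_cube J s \<times> {0..<int L}. (f p)\<^sup>2)
     - (\<Sum>t\<in>bad_freqs N D s \<epsilon>. \<Sum>x\<in>int_cube J s. (cmod (column_dft N L f x t))\<^sup>2)
     \<le> 2 * (real N)\<^sup>2 * B\<^sup>2"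
proof -
  define X where "X = int_cube J s"
  define A where "A = int_cube J D"
  define K where "K = int (card J * D * s)"
  define F where "F t = (\<Sum>x\<in>X. (cmod (column_dft N L f x t))\<^sup>2)" for t
  define W where "W = real D ^ (2 * card J)"
  let ?bad = "bad_freqs N D s \<epsilon>" and ?G = "X \<times> {0..<int L}"
  have "N > 0" "L \<le> N" using N \<open>L > 0\<close> by auto
  have bad: "?bad \<subseteq> {..<N}" by (auto simp: bad_freqs_def)
  have W: "W > 0" "W = real (card A) * real (card A)"
    using \<open>D > 0\<close> J by (simp_all add: W_def A_def card_int_cube mult_2 power_add)
  have "W / 2 * (\<Sum>t\<in>{..<N} - ?bad. F t) \<le> (\<Sum>t\<in>{..<N} - ?bad. \<Sum>a\<in>A. \<Sum>a'\<in>A.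
      (cmod (\<Sum>x\<in>X. root_char N (int t * idot J (\<lambda>j. a' j - a j) x) * column_dft N L f x t))\<^sup>2)"
    unfolding sum_distrib_left W_def F_def X_def A_def
    by (intro sum_mono) (use good_freq_energy[OF J _ _ \<epsilon>] in \<open>simp add: sum_distrib_left\<close>)
  also have "\<dots> \<le> (\<Sum>t<N. \<Sum>a\<in>A. \<Sum>a'\<in>A.
      (cmod (\<Sum>x\<in>X. root_char N (int t * idot J (\<lambda>j. a' j - a j) x) * column_dft N L f x t))\<^sup>2)"
    by (intro sum_mono2) (auto intro!: sum_nonneg)
  also have "\<dots> = (\<Sum>a\<in>A. \<Sum>a'\<in>A. \<Sum>t<N.
      (cmod (\<Sum>x\<in>X. root_char N (int t * idot J (\<lambda>j. a' j - a j) x) * column_dft N L f x t))\<^sup>2)"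
    by (subst sum.swap, rule sum.cong[OF refl], rule sum.swap)
  also have "\<dots> = (\<Sum>a\<in>A. \<Sum>a'\<in>A.
      real N * (\<Sum>b\<in>{- K..<int N - K}. (plane_sum J ?G f (\<lambda>j. a j - a' j) b)\<^sup>2))"
  proof (intro sum.cong refl)
    fix a a' assume "a \<in> A" "a' \<in> A"
    then have "z - idot J (\<lambda>j. a j - a' j) x \<in> {- K..<int N - K}"
      if "x \<in> X" "z \<in> {0..<int L}" for x z
    proof -
      have "\<bar>idot J (\<lambda>j. a j - a' j) x\<bar> \<le> K"
        using \<open>a \<in> A\<close> \<open>a' \<in> A\<close> that(1) unfolding K_def A_def X_def by (rule abs_idot_le)
      moreover have "int L + 2 * K \<le> int N"
        using N unfolding K_def by (simp flip: of_nat_mult of_nat_add add: mult.assoc)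
      ultimately show ?thesis using that(2) by auto
    qed
    then show "(\<Sum>t<N. (cmod (\<Sum>x\<in>X. root_char N (int t * idot J (\<lambda>j. a' j - a j) x) * column_dft N L f x t))\<^sup>2)
      = real N * (\<Sum>b\<in>{- K..<int N - K}. (plane_sum J ?G f (\<lambda>j. a j - a' j) b)\<^sup>2)"
      using parseval_plane_sum[of X N L J "\<lambda>j. a j - a' j" K f] J \<open>N > 0\<close> by (simp add: X_def)
  qed
  also have "\<dots> \<le> (\<Sum>a\<in>A. \<Sum>a'\<in>A. real N * (\<Sum>b\<in>{- K..<int N - K}. B\<^sup>2))"
  proof (intro sum_mono mult_left_mono)
    fix a a' b
    show "(plane_sum J ?G f (\<lambda>j. a j - a' j) b)\<^sup>2 \<le> B\<^sup>2"
      using bound power_mono[OF bound abs_ge_zero, where n = 2] by (simp add: X_def)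
  qed simp
  also have "\<dots> = W * ((real N)\<^sup>2 * B\<^sup>2)"
    by (simp add: W power2_eq_square)
  finally have "(\<Sum>t\<in>{..<N} - ?bad. F t) \<le> 2 * (real N)\<^sup>2 * B\<^sup>2"
    using W(1) by (simp add: field_simps)
  moreover have "(\<Sum>t\<in>{..<N} - ?bad. F t) = (\<Sum>t<N. F t) - (\<Sum>t\<in>?bad. F t)"
    using bad by (intro sum_diff) auto
  moreover have "(\<Sum>t<N. F t) = real N * (\<Sum>p\<in>?G. (f p)\<^sup>2)"
    unfolding F_def by (rule parseval_grid[OF \<open>L \<le> N\<close> \<open>N > 0\<close>])
  ultimately show ?thesis by (simp add: F_def X_def)
qed

subsection \<open>Discrepancy of a subset of the grid\<close>

lemma one_plus_inverse_power_le:
  fixes r :: nat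
  defines "\<epsilon> \<equiv> 1 / (4 * (real r + 1))"
  shows "(1 + \<epsilon>) ^ r \<le> 3 / 2"
proof -
  have \<epsilon>: "0 < \<epsilon>" "\<epsilon> \<le> 1 / 4" by (simp_all add: \<epsilon>_def field_simps)
  have "1 + real r * (- \<epsilon>) \<le> (1 + - \<epsilon>) ^ r"
    by (rule Bernoulli_inequality) (use \<epsilon> in auto)
  moreover have "real r * \<epsilon> \<le> 1 / 4" by (simp add: \<epsilon>_def field_simps)
  ultimately have "3 / 4 \<le> (1 - \<epsilon>) ^ r" by simp
  then have "(1 + \<epsilon>) ^ r * (3 / 4) \<le> (1 + \<epsilon>) ^ r * (1 - \<epsilon>) ^ r"
    using \<epsilon> by (intro mult_left_mono) auto
  also have "\<dots> = (1 - \<epsilon>\<^sup>2) ^ r"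
    by (simp add: power_mult_distrib[symmetric] power2_eq_square algebra_simps)
  also have "\<dots> \<le> 1"
    using \<epsilon> by (intro power_le_one) (auto simp: power_le_one)
  finally show ?thesis by simp
qed

lemma abs_floor_le_square: "real_of_int \<bar>\<lfloor>u\<rfloor>\<bar> \<le> u\<^sup>2 + 2"
proof -
  have "real_of_int \<bar>\<lfloor>u\<rfloor>\<bar> \<le> \<bar>u\<bar> + 1" by linarith
  moreover have "2 * \<bar>u\<bar> \<le> u\<^sup>2 + 1"
    using sum_squares_bound[of "\<bar>u\<bar>" 1] by simp
  ultimately show ?thesis using zero_le_power2[of u] by linarith
qed

lemma floor_eq_imp_diff_square_le:
  assumes "\<lfloor>u\<rfloor> = \<lfloor>v\<rfloor>"
  shows "(u - v)\<^sup>2 \<le> (1::real)"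
proof -
  have "\<bar>u - v\<bar> \<le> 1" using assms by linarith
  then show ?thesis by (simp add: abs_square_le_1)
qed

lemma column_dft_diff:
  "column_dft N L (\<lambda>p. f p - g p) x t = column_dft N L f x t - column_dft N L g x t"
  by (simp add: column_dft_def sum_subtractf left_diff_distrib)

lemma plane_sum_diff:
  "plane_sum J G (\<lambda>p. f p - g p) c b = plane_sum J G f c b - plane_sum J G g c b"
  by (simp add: plane_sum_def sum_subtractf)

lemma exists_close_colourings:
  fixes \<kappa> :: "('k \<times> int) set \<Rightarrow> 'k \<times> int \<Rightarrow> real"
  assumes "finite X" "X \<noteq> {}" "L > 0" "L \<le> N"
    and bad: "bad \<subseteq> {..<N}" "128 * card bad \<le> L"
    and \<kappa>: "\<And>Y p. Y \<subseteq> X \<times> {0..<int L} \<Longrightarrow> (\<kappa> Y p)\<^sup>2 \<le> 1"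
  shows "\<exists>S T. S \<subseteq> X \<times> {0..<int L} \<and> T \<subseteq> X \<times> {0..<int L}
    \<and> card X * L < 32 * card (sym_diff S T)
    \<and> (\<Sum>t\<in>bad. \<Sum>x\<in>X. (cmod (column_dft N L (\<lambda>p. \<kappa> S p - \<kappa> T p) x t))\<^sup>2)
        \<le> real N * real (card X * L) / 64"
proof -
  let ?G = "X \<times> {0..<int L}"
  define K where "K = bad \<times> X \<times> (UNIV :: bool set)"
  define part where "part \<beta> w = (if \<beta> then Re w else Im w) / sqrt (real N)" for \<beta> w
  define u where "u Y = (\<lambda>(t, x, \<beta>). part \<beta> (column_dft N L (\<kappa> Y) x t))" for Y
  define \<Phi> where "\<Phi> Y = restrict (\<lambda>k. \<lfloor>u Y k\<rfloor>) K" for Y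
  have N: "N > 0" using assms by simp
  have finbad: "finite bad" using bad(1) finite_subset by blast
  have G: "finite ?G" "?G \<noteq> {}" "card ?G = card X * L"
    using assms by (auto simp: card_cartesian_product)
  have K: "finite K" "card K = 2 * (card bad * card X)"
    using finbad assms(1) by (simp_all add: K_def card_cartesian_product)
  have K64: "64 * card K \<le> card ?G"
    using mult_right_mono[OF bad(2), of "card X"] by (simp add: K G(3) mult_ac)
  have part: "(part True w)\<^sup>2 + (part False w)\<^sup>2 = (cmod w)\<^sup>2 / real N" for w
    by (simp add: part_def power_divide cmod_power2 add_divide_distrib)
  have sumK: "(\<Sum>k\<in>K. (case k of (t, x, \<beta>) \<Rightarrow> (part \<beta> (h t x))\<^sup>2))
      = (\<Sum>t\<in>bad. \<Sum>x\<in>X. (cmod (h t x))\<^sup>2) / real N" for h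
  proof -
    have "(\<Sum>k\<in>K. (case k of (t, x, \<beta>) \<Rightarrow> (part \<beta> (h t x))\<^sup>2))
      = (\<Sum>t\<in>bad. \<Sum>x\<in>X. (part True (h t x))\<^sup>2 + (part False (h t x))\<^sup>2)"
    proof -
      have "(\<Sum>t\<in>bad. \<Sum>x\<in>X. \<Sum>\<beta>\<in>UNIV. (part \<beta> (h t x))\<^sup>2)
        = (\<Sum>k\<in>K. (case k of (t, x, \<beta>) \<Rightarrow> (part \<beta> (h t x))\<^sup>2))"
        by (simp add: K_def sum.cartesian_product split_def)
      then show ?thesis by (simp add: UNIV_bool add.commute)
    qed
    then show ?thesis by (simp add: part sum_divide_distrib)
  qed
  have "\<exists>S T. S \<subseteq> ?G \<and> T \<subseteq> ?G \<and> \<Phi> S = \<Phi> T \<and> card ?G < 32 * card (sym_diff S T)"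
  proof (rule exists_far_subsets_same_rounding[OF G(1,2) K(1) K64])
    fix Y assume Y: "Y \<subseteq> ?G"
    show "\<Phi> Y \<in> extensional K" by (simp add: \<Phi>_def)
    have "real_of_int (\<Sum>k\<in>K. \<bar>\<Phi> Y k\<bar>) \<le> (\<Sum>k\<in>K. (u Y k)\<^sup>2 + 2)"
      unfolding of_int_sum by (rule sum_mono) (simp add: \<Phi>_def abs_floor_le_square del: of_int_abs)
    also have "\<dots> = (\<Sum>k\<in>K. (u Y k)\<^sup>2) + 2 * real (card K)"
      by (simp add: sum.distrib)
    also have "(\<Sum>k\<in>K. (u Y k)\<^sup>2) = (\<Sum>k\<in>K. (case k of (t, x, \<beta>) \<Rightarrow> (part \<beta> (column_dft N L (\<kappa> Y) x t))\<^sup>2))"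
      by (rule sum.cong) (auto simp: u_def)
    also have "\<dots> = (\<Sum>t\<in>bad. \<Sum>x\<in>X. (cmod (column_dft N L (\<kappa> Y) x t))\<^sup>2) / real N"
      by (rule sumK)
    also have "\<dots> \<le> (\<Sum>t<N. \<Sum>x\<in>X. (cmod (column_dft N L (\<kappa> Y) x t))\<^sup>2) / real N"
      using bad(1) by (intro divide_right_mono sum_mono2) (auto intro: sum_nonneg)
    also have "\<dots> = (\<Sum>p\<in>?G. (\<kappa> Y p)\<^sup>2)"
      using N by (simp add: parseval_grid[OF assms(4) N])
    also have "\<dots> \<le> (\<Sum>p\<in>?G. 1)"
      by (rule sum_mono) (rule \<kappa>[OF Y])
    also have "(\<Sum>p\<in>?G. 1) + 2 * real (card K) \<le> real_of_int (2 * int (card ?G))"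
      using K64 by simp
    finally show "(\<Sum>k\<in>K. \<bar>\<Phi> Y k\<bar>) \<le> 2 * int (card ?G)"
      by (simp only: of_int_le_iff)
  qed
  then obtain S T where ST: "S \<subseteq> ?G" "T \<subseteq> ?G" "\<Phi> S = \<Phi> T" "card ?G < 32 * card (sym_diff S T)"
    by blast
  have "(\<Sum>t\<in>bad. \<Sum>x\<in>X. (cmod (column_dft N L (\<lambda>p. \<kappa> S p - \<kappa> T p) x t))\<^sup>2) / real N
    = (\<Sum>k\<in>K. (case k of (t, x, \<beta>) \<Rightarrow> (part \<beta> (column_dft N L (\<lambda>p. \<kappa> S p - \<kappa> T p) x t))\<^sup>2))"
    by (rule sumK[symmetric])
  also have "\<dots> = (\<Sum>k\<in>K. (u S k - u T k)\<^sup>2)"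
    by (rule sum.cong) (auto simp: u_def part_def column_dft_diff diff_divide_distrib)
  also have "\<dots> \<le> (\<Sum>k\<in>K. 1)"
  proof (intro sum_mono floor_eq_imp_diff_square_le)
    fix k assume "k \<in> K"
    then show "\<lfloor>u S k\<rfloor> = \<lfloor>u T k\<rfloor>"
      using fun_cong[OF ST(3), of k] by (simp add: \<Phi>_def)
  qed
  also have "\<dots> \<le> real (card X * L) / 64"
    using K64 unfolding G(3) by (simp flip: of_nat_mult)
  finally have "(\<Sum>t\<in>bad. \<Sum>x\<in>X. (cmod (column_dft N L (\<lambda>p. \<kappa> S p - \<kappa> T p) x t))\<^sup>2)
      \<le> real N * real (card X * L) / 64"
    using N by (simp add: field_simps)
  with ST(1,2) ST(4)[unfolded G(3)] show ?thesis by (intro exI conjI)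
qed

lemma exists_grid_subset_plane_discrepancy:
  fixes J :: "'j set"
  assumes J: "finite J" and "s > 0"
    and L: "L = 4096 * (card J + 1)\<^sup>2 * s\<^sup>2"
  shows "\<exists>Y \<subseteq> int_cube J s \<times> {0..<int L}. \<forall>f \<in> Y \<rightarrow> {-1, 1 :: int}. \<exists>c b.
     sqrt (real s ^ card J) / 32 \<le> \<bar>real_of_int (\<Sum>p | p \<in> Y \<and> snd p - idot J c (fst p) = b. f p)\<bar>"
proof (rule ccontr)
  define r where "r = card J"
  define D where "D = 2048 * (r + 1) * s"
  define N where "N = 2 * L"
  define \<epsilon> where "\<epsilon> = 1 / (4 * (real r + 1))"
  define \<Delta> where "\<Delta> = sqrt (real s ^ r) / 32"
  let ?X = "int_cube J s" and ?bad = "bad_freqs N D s \<epsilon>"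
  let ?G = "?X \<times> {0..<int L}"
  assume neg: "\<not> ?thesis"
  have ex: "\<exists>f. f \<in> Y \<rightarrow> {-1, 1 :: int} \<and>
      (\<forall>c b. \<bar>real_of_int (\<Sum>p | p \<in> Y \<and> snd p - idot J c (fst p) = b. f p)\<bar> < \<Delta>)"
    if "Y \<subseteq> ?G" for Y
  proof -
    have "\<not> (\<forall>f \<in> Y \<rightarrow> {-1, 1 :: int}. \<exists>c b.
       \<Delta> \<le> \<bar>real_of_int (\<Sum>p | p \<in> Y \<and> snd p - idot J c (fst p) = b. f p)\<bar>)"
    proof
      assume *: "\<forall>f \<in> Y \<rightarrow> {-1, 1 :: int}. \<exists>c b.
       \<Delta> \<le> \<bar>real_of_int (\<Sum>p | p \<in> Y \<and> snd p - idot J c (fst p) = b. f p)\<bar>"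
      show False
        by (rule notE[OF neg], intro exI conjI, rule that, rule *[unfolded \<Delta>_def r_def])
    qed
    then show ?thesis by (simp only: Bex_def not_le ball_simps not_ex)
  qed
  have "\<forall>Y. \<exists>f. Y \<subseteq> ?G \<longrightarrow> f \<in> Y \<rightarrow> {-1, 1 :: int} \<and>
      (\<forall>c b. \<bar>real_of_int (\<Sum>p | p \<in> Y \<and> snd p - idot J c (fst p) = b. f p)\<bar> < \<Delta>)"
    by (intro allI) (simp only: ex_simps, intro impI, rule ex)
  from choice[OF this] obtain \<phi> where "\<forall>Y. Y \<subseteq> ?G \<longrightarrow> \<phi> Y \<in> Y \<rightarrow> {-1, 1 :: int} \<and>
      (\<forall>c b. \<bar>real_of_int (\<Sum>p | p \<in> Y \<and> snd p - idot J c (fst p) = b. \<phi> Y p)\<bar> < \<Delta>)" ..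
  then have \<phi>: "\<And>Y. Y \<subseteq> ?G \<Longrightarrow> \<phi> Y \<in> Y \<rightarrow> {-1, 1 :: int}"
    and disc: "\<And>Y c b. Y \<subseteq> ?G \<Longrightarrow>
      \<bar>real_of_int (\<Sum>p | p \<in> Y \<and> snd p - idot J c (fst p) = b. \<phi> Y p)\<bar> < \<Delta>"
    by simp_all
  define \<kappa> where "\<kappa> Y p = (if p \<in> Y then real_of_int (\<phi> Y p) else 0)" for Y p
  have \<epsilon>: "\<epsilon> \<ge> 0" "(1 + \<epsilon>) ^ card J \<le> 3 / 2"
    using one_plus_inverse_power_le[of r] by (simp_all add: \<epsilon>_def r_def)
  have "L > 0" using L \<open>s > 0\<close> by simp
  have "D > 0" using \<open>s > 0\<close> by (simp add: D_def)
  have L2: "L = 2 * (r + 1) * D * s"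
    by (simp add: L D_def r_def power2_eq_square algebra_simps)
  have NL: "L + 2 * card J * D * s \<le> N"
    by (simp add: N_def L2 r_def)
  have X: "finite ?X" "card ?X = s ^ r" "?X \<noteq> {}"
    using J \<open>s > 0\<close> card_int_cube[of J s] by (auto simp: r_def)
  have finG: "finite ?G" using X(1) by simp
  have "D * s \<le> N" unfolding N_def L2 by simp
  then have "real (card ?bad) * (\<epsilon> * real D) \<le> 2 * real s * real N"
    by (rule card_bad_freqs[OF _ \<epsilon>(1) \<open>D > 0\<close>])
  moreover have "\<epsilon> * real D = 512 * real s"
    by (simp add: \<epsilon>_def D_def field_simps)
  ultimately have "256 * real (card ?bad) \<le> real N"
    using \<open>s > 0\<close> by (simp add: field_simps)
  then have bad: "128 * card ?bad \<le> L"
    unfolding N_def by linarith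
  have "\<exists>S T. S \<subseteq> ?G \<and> T \<subseteq> ?G \<and> card ?X * L < 32 * card (sym_diff S T)
    \<and> (\<Sum>t\<in>?bad. \<Sum>x\<in>?X. (cmod (column_dft N L (\<lambda>p. \<kappa> S p - \<kappa> T p) x t))\<^sup>2)
        \<le> real N * real (card ?X * L) / 64"
  proof (rule exists_close_colourings)
    fix Y p assume "Y \<subseteq> ?G"
    then show "(\<kappa> Y p)\<^sup>2 \<le> 1"
      using \<phi>[of Y] by (auto simp: \<kappa>_def Pi_iff)
  qed (use X \<open>L > 0\<close> bad in \<open>auto simp: N_def bad_freqs_def\<close>)
  then obtain S T where ST: "S \<subseteq> ?G" "T \<subseteq> ?G" "card ?X * L < 32 * card (sym_diff S T)"
    and bad_energy: "(\<Sum>t\<in>?bad. \<Sum>x\<in>?X. (cmod (column_dft N L (\<lambda>p. \<kappa> S p - \<kappa> T p) x t))\<^sup>2)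
        \<le> real N * real (card ?X * L) / 64"
    by blast
  have plane: "\<bar>plane_sum J ?G (\<kappa> Y) c b\<bar> \<le> \<Delta>" if "Y \<subseteq> ?G" for Y c b
  proof -
    have "plane_sum J ?G (\<kappa> Y) c b = (\<Sum>p | p \<in> Y \<and> snd p - idot J c (fst p) = b. \<kappa> Y p)"
      unfolding plane_sum_def
      by (rule sum.mono_neutral_right) (use that finG in \<open>auto simp: \<kappa>_def\<close>)
    also have "\<dots> = real_of_int (\<Sum>p | p \<in> Y \<and> snd p - idot J c (fst p) = b. \<phi> Y p)"
      by (simp add: \<kappa>_def)
    finally show ?thesis using disc[OF that, of c b] by simp
  qed
  have "real N * (\<Sum>p\<in>?G. (\<kappa> S p - \<kappa> T p)\<^sup>2)
     - (\<Sum>t\<in>?bad. \<Sum>x\<in>?X. (cmod (column_dft N L (\<lambda>p. \<kappa> S p - \<kappa> T p) x t))\<^sup>2)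
     \<le> 2 * (real N)\<^sup>2 * (2 * \<Delta>)\<^sup>2"
  proof (rule plane_sums_energy[OF J \<open>D > 0\<close> \<open>L > 0\<close> NL \<epsilon>])
    fix c b
    show "\<bar>plane_sum J ?G (\<lambda>p. \<kappa> S p - \<kappa> T p) c b\<bar> \<le> 2 * \<Delta>"
      unfolding plane_sum_diff using plane[OF ST(1), of c b] plane[OF ST(2), of c b] by linarith
  qed
  moreover have "real N * (real (card ?X * L) / 32) < real N * (\<Sum>p\<in>?G. (\<kappa> S p - \<kappa> T p)\<^sup>2)"
  proof (rule mult_strict_left_mono)
    have "real (card ?X * L) < 32 * real (card (sym_diff S T))"
      using ST(3) by linarith
    also have "real (card (sym_diff S T)) = (\<Sum>p\<in>sym_diff S T. 1)" by simp
    also have "\<dots> \<le> (\<Sum>p\<in>sym_diff S T. (\<kappa> S p - \<kappa> T p)\<^sup>2)"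
      using \<phi>[OF ST(1)] \<phi>[OF ST(2)] by (intro sum_mono) (auto simp: \<kappa>_def Pi_iff)
    also have "\<dots> \<le> (\<Sum>p\<in>?G. (\<kappa> S p - \<kappa> T p)\<^sup>2)"
      using ST finG by (intro sum_mono2) auto
    finally show "real (card ?X * L) / 32 < (\<Sum>p\<in>?G. (\<kappa> S p - \<kappa> T p)\<^sup>2)" by simp
  qed (use \<open>L > 0\<close> in \<open>simp add: N_def\<close>)
  ultimately have "real N * (real (card ?X * L) / 64) < real N * (8 * real N * \<Delta>\<^sup>2)"
    using bad_energy by (simp add: power2_eq_square)
  then have "real (card ?X * L) / 64 < 8 * real N * \<Delta>\<^sup>2"
    using \<open>L > 0\<close> by (simp add: N_def)
  also have "\<Delta>\<^sup>2 = real s ^ r / 1024"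
    by (simp add: \<Delta>_def power_divide)
  finally show False
    by (simp add: N_def X(2))
qed

subsection \<open>Hyperplanes in Euclidean space\<close>

lemma hyperplanes_nonempty: "(hyperplanes :: 'a::euclidean_space set set) \<noteq> {}"
proof -
  obtain b :: 'a where "b \<in> Basis" using nonempty_Basis by blast
  then have "{x. b \<bullet> x = 0} \<in> hyperplanes"
    unfolding hyperplanes_def using nonzero_Basis by blast
  then show ?thesis by blast
qed

text \<open>Only finitely many traces on \<open>Y\<close> occur, so \<open>Y\<close> can be padded by points avoiding one
  representative hyperplane for each trace.\<close>
lemma hyperplane_disc_extend:
  fixes Y :: "'a::euclidean_space set"
  assumes "finite Y" "card Y \<le> n"
    and Y: "\<And>f. f \<in> Y \<rightarrow> {-1, 1 :: int} \<Longrightarrow> \<exists>H\<in>hyperplanes. k \<le> real_of_int \<bar>\<Sum>y\<in>H \<inter> Y. f y\<bar>"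
  shows "\<exists>X :: 'a set. finite X \<and> card X = n \<and> k \<le> real_of_int (disc X hyperplanes)"
proof -
  define \<T> where "\<T> = (\<lambda>H. H \<inter> Y) ` (hyperplanes :: 'a set set)"
  have "\<forall>T\<in>\<T>. \<exists>H. H \<in> hyperplanes \<and> H \<inter> Y = T" by (auto simp: \<T>_def)
  then obtain h where h: "\<And>T. T \<in> \<T> \<Longrightarrow> h T \<in> hyperplanes \<and> h T \<inter> Y = T" by metis
  have "finite \<T>"
    by (rule finite_subset[of _ "Pow Y"]) (use assms(1) in \<open>auto simp: \<T>_def\<close>)
  have neg: "negligible (h T)" if "T \<in> \<T>" for T
    using h[OF that] by (auto simp: hyperplanes_def intro!: negligible_hyperplane)
  have "negligible (\<Union>(h ` \<T>))"
    by (rule negligible_Union) (use \<open>finite \<T>\<close> neg in blast)+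
  then have "negligible (\<Union>(h ` \<T>) \<union> Y)"
    by (rule negligible_Un) (rule negligible_finite[OF assms(1)])
  have "infinite (- (\<Union>(h ` \<T>) \<union> Y))"
  proof
    assume "finite (- (\<Union>(h ` \<T>) \<union> Y))"
    from this \<open>negligible (\<Union>(h ` \<T>) \<union> Y)\<close>
    have "negligible (- (\<Union>(h ` \<T>) \<union> Y) \<union> (\<Union>(h ` \<T>) \<union> Y))"
      by (rule negligible_Un[OF negligible_finite])
    then show False by (metis Compl_partition2 non_negligible_UNIV)
  qed
  then obtain E where E: "finite E" "card E = n - card Y" "E \<subseteq> - (\<Union>(h ` \<T>) \<union> Y)"
    using infinite_arbitrarily_large by blast
  define X where "X = Y \<union> E"
  have "finite X" using assms(1) E(1) by (simp add: X_def)
  have "Y \<inter> E = {}" using E(3) by blast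
  then have "card X = n"
    using assms(1,2) E(1,2) by (simp add: X_def card_Un_disjoint)
  have "\<lceil>k\<rceil> \<le> disc X hyperplanes"
    unfolding le_disc_iff[OF \<open>finite X\<close> hyperplanes_nonempty]
  proof
    fix f :: "'a \<Rightarrow> int" assume "f \<in> X \<rightarrow>\<^sub>E {-1, 1}"
    then have "f \<in> Y \<rightarrow> {-1, 1}" by (auto simp: X_def PiE_def)
    then obtain H where H: "H \<in> hyperplanes" "k \<le> real_of_int \<bar>\<Sum>y\<in>H \<inter> Y. f y\<bar>"
      using Y by blast
    then have "H \<inter> Y \<in> \<T>" by (auto simp: \<T>_def)
    then have "h (H \<inter> Y) \<in> hyperplanes" "h (H \<inter> Y) \<inter> X = H \<inter> Y"
      using h E(3) by (auto simp: X_def)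
    then show "\<exists>A\<in>hyperplanes. \<lceil>k\<rceil> \<le> \<bar>\<Sum>x\<in>A \<inter> X. f x\<bar>"
      using H(2) by (intro bexI[of _ "h (H \<inter> Y)"]) (simp_all add: ceiling_le_iff)
  qed
  then show ?thesis
    using \<open>finite X\<close> \<open>card X = n\<close> by (auto simp: ceiling_le_iff)
qed

lemma exists_point_set_hyperplane_discrepancy:
  assumes "s > 0"
  shows "\<exists>Y :: (real ^ 'd::finite) set. finite Y \<and> card Y \<le> 4096 * CARD('d)\<^sup>2 * s ^ (CARD('d) + 1) \<and>
    (\<forall>f \<in> Y \<rightarrow> {-1, 1 :: int}. \<exists>H\<in>hyperplanes.
      sqrt (real s ^ (CARD('d) - 1)) / 32 \<le> real_of_int \<bar>\<Sum>y\<in>H \<inter> Y. f y\<bar>)"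
proof -
  define i0 :: 'd where "i0 = undefined"
  define J where "J = UNIV - {i0}"
  define L where "L = 4096 * (card J + 1)\<^sup>2 * s\<^sup>2"
  let ?G = "int_cube J s \<times> {0..<int L}"
  define P :: "('d \<Rightarrow> int) \<times> int \<Rightarrow> real ^ 'd"
    where "P p = (\<chi> i. if i = i0 then real_of_int (snd p) else real_of_int (fst p i))" for p
  have J: "finite J" "i0 \<notin> J" "insert i0 J = UNIV" by (auto simp: J_def)
  have cJ: "card J = CARD('d) - 1" "CARD('d) > 0" by (simp_all add: J_def)
  obtain Y0 where Y0: "Y0 \<subseteq> ?G"
    and disc: "\<And>f. f \<in> Y0 \<rightarrow> {-1, 1 :: int} \<Longrightarrow> \<exists>c b. sqrt (real s ^ card J) / 32
       \<le> \<bar>real_of_int (\<Sum>p | p \<in> Y0 \<and> snd p - idot J c (fst p) = b. f p)\<bar>"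
    using exists_grid_subset_plane_discrepancy[OF J(1) assms L_def] by blast
  have finG: "finite ?G" using J(1) by simp
  have inj: "inj_on P Y0"
  proof (rule inj_onI)
    fix p q assume pq: "p \<in> Y0" "q \<in> Y0" "P p = P q"
    then have eq: "P p $ i = P q $ i" for i by simp
    have "snd p = snd q" using eq[of i0] by (simp add: P_def)
    moreover have "fst p = fst q"
    proof (rule extensionalityI[of _ J])
      show "fst p \<in> extensional J" "fst q \<in> extensional J"
        using pq(1,2) Y0 by (auto simp: int_cube_def PiE_iff)
      fix j assume "j \<in> J"
      then show "fst p j = fst q j" using eq[of j] J(2) by (auto simp: P_def split: if_splits)
    qed
    ultimately show "p = q" by (rule prod_eqI[rotated])
  qed
  have "card (P ` Y0) \<le> card ?G"
    using card_mono[OF finG Y0] by (simp only: card_image[OF inj])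
  also have "card ?G = 4096 * CARD('d)\<^sup>2 * (s ^ (CARD('d) - 1) * s\<^sup>2)"
  proof -
    have "L = 4096 * CARD('d)\<^sup>2 * s\<^sup>2"
      using cJ by (simp add: L_def)
    moreover have "card ?G = s ^ (CARD('d) - 1) * L"
      using cJ J(1) by (simp add: card_cartesian_product card_int_cube)
    ultimately show ?thesis by (simp only: mult_ac)
  qed
  also have "s ^ (CARD('d) - 1) * s\<^sup>2 = s ^ (CARD('d) + 1)"
    using cJ(2) by (simp flip: power_add)
  finally have card: "card (P ` Y0) \<le> 4096 * CARD('d)\<^sup>2 * s ^ (CARD('d) + 1)" .
  have "\<exists>H\<in>hyperplanes. sqrt (real s ^ (CARD('d) - 1)) / 32 \<le> real_of_int \<bar>\<Sum>y\<in>H \<inter> P ` Y0. f y\<bar>"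
    if "f \<in> P ` Y0 \<rightarrow> {-1, 1 :: int}" for f
  proof -
    from that have "f \<circ> P \<in> Y0 \<rightarrow> {-1, 1}" by auto
    then obtain c b where cb: "sqrt (real s ^ card J) / 32
       \<le> \<bar>real_of_int (\<Sum>p | p \<in> Y0 \<and> snd p - idot J c (fst p) = b. (f \<circ> P) p)\<bar>"
      using disc by blast
    define a :: "real ^ 'd" where "a = (\<chi> i. if i = i0 then 1 else - real_of_int (c i))"
    define H where "H = {v. a \<bullet> v = real_of_int b}"
    have "a $ i0 = 1" by (simp add: a_def)
    then have "a \<noteq> 0" by auto
    then have "H \<in> hyperplanes" by (auto simp: H_def hyperplanes_def)
    have inner: "a \<bullet> P p = real_of_int (snd p - idot J c (fst p))" for p
    proof -
      have "a \<bullet> P p = (\<Sum>i\<in>insert i0 J. a $ i * P p $ i)"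
        by (simp add: inner_vec_def J(3))
      also have "\<dots> = real_of_int (snd p) + (\<Sum>i\<in>J. a $ i * P p $ i)"
        using J(1,2) by (simp add: a_def P_def)
      also have "(\<Sum>i\<in>J. a $ i * P p $ i) = (\<Sum>i\<in>J. - real_of_int (c i * fst p i))"
        using J(2) by (intro sum.cong) (auto simp: a_def P_def)
      finally show ?thesis by (simp add: idot_def sum_negf)
    qed
    have "H \<inter> P ` Y0 = P ` {p. p \<in> Y0 \<and> snd p - idot J c (fst p) = b}"
      by (auto simp: H_def inner simp del: of_int_diff)
    then have sum_eq: "(\<Sum>y\<in>H \<inter> P ` Y0. f y) = (\<Sum>p | p \<in> Y0 \<and> snd p - idot J c (fst p) = b. (f \<circ> P) p)"
      using inj by (auto simp: sum.reindex inj_on_def)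
    show ?thesis
      using cb \<open>H \<in> hyperplanes\<close> unfolding sum_eq[symmetric] cJ(1) of_int_abs[symmetric] by blast
  qed
  moreover have "finite (P ` Y0)" using Y0 finG finite_subset by blast
  ultimately show ?thesis using card by blast
qed

lemma hyperplane_disc_lower_bound:
  defines "\<alpha> \<equiv> 1 / 2 - 1 / (real CARD('d::finite) + 1)"
  shows "\<exists>c>0. \<forall>n\<ge>1. \<exists>X :: (real ^ 'd) set. finite X \<and> card X = n \<and>
    c * real n powr \<alpha> \<le> real_of_int (disc X hyperplanes)"
proof -
  define d where "d = CARD('d)"
  define M where "M = 4096 * d\<^sup>2"
  define r where "r = d - 1"
  have "d > 0" by (simp add: d_def)
  then have M: "real M > 0" and r: "real r = real d - 1" by (auto simp: M_def r_def)
  have \<alpha>: "\<alpha> = 1 / (real d + 1) * (real r / 2)"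
    using \<open>d > 0\<close> by (simp add: \<alpha>_def d_def[symmetric] r field_simps)
  have "\<alpha> \<ge> 0" unfolding \<alpha> by simp
  define c where "c = real M powr - \<alpha> * 2 powr - (real r / 2) / 32"
  have c: "c * real n powr \<alpha> = (real n / real M) powr \<alpha> * 2 powr - (real r / 2) / 32" for n
    using M by (simp add: c_def powr_divide powr_minus field_simps)
  have "\<exists>X :: (real ^ 'd) set. finite X \<and> card X = n \<and> c * real n powr \<alpha> \<le> real_of_int (disc X hyperplanes)"
    if "n \<ge> 1" for n
  proof (cases "M \<le> n")
    case True
    define y where "y = (real n / real M) powr (1 / (real d + 1))"
    define s where "s = nat \<lfloor>y\<rfloor>"
    have "y \<ge> 1" using True M by (simp add: y_def ge_one_powr_ge_zero)
    then have "1 \<le> \<lfloor>y\<rfloor>" "real s = real_of_int \<lfloor>y\<rfloor>" by (simp_all add: s_def)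
    then have s: "s > 0" "real s \<le> y" "y \<le> 2 * real s"
      by linarith+
    have "real s ^ (d + 1) \<le> y ^ (d + 1)"
      using s(2) by (intro power_mono) auto
    also have "y ^ (d + 1) = y powr (real d + 1)"
      using \<open>y \<ge> 1\<close> by (subst powr_realpow[symmetric]) (auto simp: add.commute)
    also have "\<dots> = real n / real M"
      unfolding y_def powr_powr using M \<open>n \<ge> 1\<close> by simp
    finally have "real M * real s ^ (d + 1) \<le> real n"
      using M by (simp add: field_simps)
    then have Mn: "M * s ^ (d + 1) \<le> n"
      by (simp flip: of_nat_le_iff[where 'a=real])
    obtain Y :: "(real ^ 'd) set" where Y: "finite Y" "card Y \<le> M * s ^ (d + 1)"
      "\<And>f. f \<in> Y \<rightarrow> {-1, 1 :: int} \<Longrightarrow> \<exists>H\<in>hyperplanes.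
        sqrt (real s ^ r) / 32 \<le> real_of_int \<bar>\<Sum>y\<in>H \<inter> Y. f y\<bar>"
      using exists_point_set_hyperplane_discrepancy[OF s(1), where 'd='d]
      unfolding M_def d_def r_def by blast
    obtain X :: "(real ^ 'd) set" where X: "finite X" "card X = n"
      "sqrt (real s ^ r) / 32 \<le> real_of_int (disc X hyperplanes)"
      using hyperplane_disc_extend[OF Y(1) order_trans[OF Y(2) Mn] Y(3)] by blast
    have "c * real n powr \<alpha> = (y / 2) powr (real r / 2) / 32"
    proof -
      have "(real n / real M) powr \<alpha> = y powr (real r / 2)"
        by (simp only: \<alpha> y_def powr_powr)
      then show ?thesis
        unfolding c using \<open>y \<ge> 1\<close> by (simp add: powr_divide powr_minus_divide)
    qed
    also have "\<dots> \<le> real s powr (real r / 2) / 32"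
      using s \<open>y \<ge> 1\<close> by (intro divide_right_mono powr_mono2) auto
    also have "real s powr (real r / 2) = sqrt (real s ^ r)"
      using s(1) by (simp add: powr_half_sqrt[symmetric] powr_realpow[symmetric] powr_powr)
    finally show ?thesis using X by force
  next
    case False
    have "(real n / real M) powr \<alpha> \<le> 1"
      using False M \<open>\<alpha> \<ge> 0\<close> by (intro powr_le1) auto
    moreover have "2 powr - (real r / 2) \<le> (1::real)"
      by (simp add: powr_minus_divide ge_one_powr_ge_zero)
    ultimately have "(real n / real M) powr \<alpha> * 2 powr - (real r / 2) \<le> 1 * 1"
      by (intro mult_mono) auto
    then have le1: "c * real n powr \<alpha> \<le> 1" unfolding c by simp
    have "\<exists>X :: (real ^ 'd) set. finite X \<and> card X = n \<and> 1 \<le> real_of_int (disc X hyperplanes)"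
    proof (rule hyperplane_disc_extend)
      obtain b :: "real ^ 'd" where "b \<in> Basis" using nonempty_Basis by blast
      then have H: "{x. b \<bullet> x = 0} \<in> hyperplanes"
        unfolding hyperplanes_def using nonzero_Basis by blast
      fix f :: "real ^ 'd \<Rightarrow> int" assume "f \<in> {0} \<rightarrow> {-1, 1}"
      moreover have "{x. b \<bullet> x = 0} \<inter> {0} = {0}" by auto
      ultimately have "1 \<le> real_of_int \<bar>\<Sum>y\<in>{x. b \<bullet> x = 0} \<inter> {0}. f y\<bar>" by auto
      then show "\<exists>H\<in>hyperplanes. 1 \<le> real_of_int \<bar>\<Sum>y\<in>H \<inter> {0}. f y\<bar>" using H by blast
    qed (use that in auto)
    then show ?thesis using le1 order_trans by blast
  qed
  moreover have "c > 0" using M by (simp add: c_def)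
  ultimately show ?thesis by blast
qed

theorem theorem1p2:
  "\<exists>c::real. c > 0 \<and>
    (\<forall>n::nat. n \<ge> 2 \<longrightarrow>
      (\<exists>X :: (real ^ 'd::finite) set. finite X \<and> card X = n \<and>
        real_of_int (disc X hyperplanes)
          \<ge> c * real n powr (1 / 2 - 1 / (real CARD('d) + 1)) * inverse (ln (real n))))"
proof -
  let ?\<alpha> = "1 / 2 - 1 / (real CARD('d) + 1)"
  obtain c where c: "c > 0" and X: "\<And>n. n \<ge> 1 \<Longrightarrow> \<exists>X :: (real ^ 'd) set. finite X \<and> card X = n \<and>
    c * real n powr ?\<alpha> \<le> real_of_int (disc X hyperplanes)"
    using hyperplane_disc_lower_bound[where 'd='d] by blast
  have weaken: "c * ln 2 * y * inverse (ln (real n)) \<le> c * y" if "n \<ge> 2" "y \<ge> 0" for n :: nat and y :: real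
  proof -
    have "ln 2 * inverse (ln (real n)) \<le> 1"
      using that(1) by (simp flip: divide_inverse)
    then have "c * y * (ln 2 * inverse (ln (real n))) \<le> c * y * 1"
      using c that(2) by (intro mult_left_mono) auto
    then show ?thesis by (simp only: mult_ac mult_1_right)
  qed
  show ?thesis
  proof (intro exI[of _ "c * ln 2"] conjI allI impI)
    show "c * ln 2 > 0" using c by simp
    fix n :: nat assume "n \<ge> 2"
    then have "n \<ge> 1" by simp
    from X[OF this] obtain Y :: "(real ^ 'd) set" where "finite Y" "card Y = n"
      "c * real n powr ?\<alpha> \<le> real_of_int (disc Y hyperplanes)"
      by blast
    then show "\<exists>X :: (real ^ 'd) set. finite X \<and> card X = n \<and>
        c * ln 2 * real n powr ?\<alpha> * inverse (ln (real n)) \<le> real_of_int (disc X hyperplanes)"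
      using order_trans[OF weaken[OF \<open>n \<ge> 2\<close> powr_ge_zero]] by (intro exI[of _ Y] conjI)
  qed
qed

end
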